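(* Let $G$ be a finite group and let $\sigma:G\to \mathrm{Aut}(\mathcal{S}^n)$ be an orthogonal linear representation of $G$ on $\mathcal{S}^n$ with $\sigma(g)(\mathcal{S}^n_+)\subseteq \mathcal{S}^n_+$ for all $g\in G$. Let $\mathcal{L}\subseteq\mathcal{S}^n$ be an affine subspace and $C\in\mathcal{S}^n$, and suppose that the semidefinite program $$F:=\min_{X\in\mathcal{L}\cap\mathcal{S}^n_+}\langle C,X\rangle$$ is invariant with respect to $\sigma$. Let $\mathcal{F}:=\{X\in\mathcal{S}^n \mid X=\sigma(g)(X)\ \text{for all } g\in G\}$ be the fixed-point subspace, and let $$F_\sigma:=\min_{X\in\mathcal{F}\cap\mathcal{L}\cap\mathcal{S}^n_+}\langle C,X\rangle$$ be the optimal value of the fixed-point restricted semidefinite program. Then the two optimal values are equal: $F=F_\sigma$.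
   Context: $\mathcal{S}^n$ is the space of real symmetric $n\times n$ matrices with the inner product $\langle\cdot,\cdot\rangle$ (the trace inner product), and $\mathcal{S}^n_+\subset\mathcal{S}^n$ is the convex cone of positive semidefinite matrices. $\mathrm{Aut}(\mathcal{S}^n)$ is the group of invertible linear maps of $\mathcal{S}^n$. The representation $\sigma$ is orthogonal if for every $g\in G$ the inverse of $\sigma(g)$ equals its adjoint with respect to $\langle\cdot,\cdot\rangle$. The symbol $\min$ denotes the optimal value of the optimization problem (the infimum of the cost over the feasible set, attained or not). A semidefinite program $\min_{X\in\mathcal{L}\cap\mathcal{S}^n_+}\langle C,X\rangle$ is called invariant with respect to $\sigma$ if: (i) the feasible set is invariant: $X\in\mathcal{L}\cap\mathcal{S}^n_+$ implies $\sigma(g)(X)\in\mathcal{L}\cap\mathcal{S}^n_+$ for all $g\in G$; (ii) the cost function is invariant: $\langle C,X\rangle=\langle C,\sigma(g)(X)\rangle$ for all $g\in G$ and all $X\in\mathcal{L}\cap\mathcal{S}^n_+$. *)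

theory Defs
  imports "HOL-Analysis.Analysis" "HOL-Algebra.Bij"
begin

definition sym_mats :: "(real^'n^'n) set"
  where "sym_mats = {X. transpose X = X}"

definition psd_mats :: "(real^'n^'n) set"
  where "psd_mats = {X \<in> sym_mats. \<forall>v. v \<bullet> (X *v v) \<ge> 0}"

definition trace_inner :: "real^'n^'n \<Rightarrow> real^'n^'n \<Rightarrow> real"
  where "trace_inner A B = trace (A ** B)"

text \<open>On symmetric matrices this is the restriction of the library's inner product
  on \<^typ>\<open>real^'n^'n\<close>.\<close>

lemma trace_inner_eq_inner:
  assumes "A \<in> sym_mats"
  shows "trace_inner A B = A \<bullet> B"
proof -
  have A: "A $ i $ j = A $ j $ i" for i j
    using assms by (metis (mono_tags, lifting) mem_Collect_eq sym_mats_def transpose_def vec_lambda_beta)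
  have "trace_inner A B = (\<Sum>i\<in>UNIV. \<Sum>k\<in>UNIV. A $ k $ i * B $ k $ i)"
    unfolding trace_inner_def trace_def matrix_matrix_mult_def by (simp add: A)
  also have "\<dots> = (\<Sum>k\<in>UNIV. \<Sum>i\<in>UNIV. A $ k $ i * B $ k $ i)"
    by (rule sum.swap)
  also have "\<dots> = A \<bullet> B"
    by (simp add: inner_vec_def)
  finally show ?thesis .
qed

lemma subspace_sym_mats: "subspace sym_mats"
  unfolding subspace_def sym_mats_def by (auto simp: transpose_def vec_eq_iff)

text \<open>The elements of the group of invertible linear maps of \<^term>\<open>sym_mats\<close> are, as in
  \<^const>\<open>BijGroup\<close>, extensional functions (undefined outside \<^term>\<open>sym_mats\<close>),
  so linearity can only be demanded on \<^term>\<open>sym_mats\<close>.\<close>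

definition linear_on_sym :: "(real^'n^'n \<Rightarrow> real^'n^'n) \<Rightarrow> bool"
  where "linear_on_sym f \<longleftrightarrow>
    (\<forall>X\<in>sym_mats. \<forall>Y\<in>sym_mats. f (X + Y) = f X + f Y) \<and>
    (\<forall>c. \<forall>X\<in>sym_mats. f (c *\<^sub>R X) = c *\<^sub>R f X)"

definition Aut_sym :: "(real^'n^'n \<Rightarrow> real^'n^'n) monoid"
  where "Aut_sym = BijGroup sym_mats\<lparr>carrier := {f \<in> Bij sym_mats. linear_on_sym f}\<rparr>"

lemma group_Aut_sym: "group (Aut_sym :: (real^'n^'n \<Rightarrow> real^'n^'n) monoid)"
proof -
  let ?S = "sym_mats :: (real^'n^'n) set"
  let ?B = "BijGroup ?S"
  interpret B: group ?B by (rule group_BijGroup)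
  have add: "X + Y \<in> ?S" if "X \<in> ?S" "Y \<in> ?S" for X Y
    using that subspace_add[OF subspace_sym_mats] by blast
  have scale: "c *\<^sub>R X \<in> ?S" if "X \<in> ?S" for X c
    using that subspace_scale[OF subspace_sym_mats] by blast
  have inv: "inv\<^bsub>?B\<^esub> f = (\<lambda>x\<in>?S. inv_into ?S f x)" if "f \<in> Bij ?S" for f
    using that by (rule inv_BijGroup)
  have "subgroup {f \<in> Bij ?S. linear_on_sym f} ?B"
  proof (rule B.subgroupI)
    show "{f \<in> Bij ?S. linear_on_sym f} \<subseteq> carrier ?B"
      by (auto simp: BijGroup_def)
    have "(\<lambda>x\<in>?S. x) \<in> {f \<in> Bij ?S. linear_on_sym f}"
      by (auto simp: id_Bij linear_on_sym_def add scale)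
    then show "{f \<in> Bij ?S. linear_on_sym f} \<noteq> {}" by blast
  next
    fix f assume "f \<in> {f \<in> Bij ?S. linear_on_sym f}"
    then have f: "f \<in> Bij ?S" "linear_on_sym f" by auto
    define g where "g = inv_into ?S f"
    have bij: "bij_betw f ?S ?S" using f by (simp add: Bij_def)
    have gS: "g X \<in> ?S" and fg: "f (g X) = X" and gf: "g (f X) = X" if "X \<in> ?S" for X
      using that Bij_inv_into_mem[OF f(1)] bij
      by (auto simp: g_def bij_betw_inv_into_right bij_betw_inv_into_left)
    have "g (X + Y) = g X + g Y" if "X \<in> ?S" "Y \<in> ?S" for X Y
    proof -
      have "f (g X + g Y) = X + Y"
        using f(2) gS fg that by (simp add: linear_on_sym_def)
      then show ?thesis using gf[of "g X + g Y"] add gS that by metis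
    qed
    moreover have "g (c *\<^sub>R X) = c *\<^sub>R g X" if "X \<in> ?S" for X c
    proof -
      have "f (c *\<^sub>R g X) = c *\<^sub>R X"
        using f(2) gS fg that by (simp add: linear_on_sym_def)
      then show ?thesis using gf[of "c *\<^sub>R g X"] scale gS that by metis
    qed
    ultimately have "linear_on_sym (\<lambda>x\<in>?S. g x)"
      by (auto simp: linear_on_sym_def add scale)
    then show "inv\<^bsub>?B\<^esub> f \<in> {f \<in> Bij ?S. linear_on_sym f}"
      using inv[OF f(1)] restrict_inv_into_Bij[OF f(1)] by (simp add: g_def)
  next
    fix f h assume "f \<in> {f \<in> Bij ?S. linear_on_sym f}" "h \<in> {f \<in> Bij ?S. linear_on_sym f}"
    then have f: "f \<in> Bij ?S" "linear_on_sym f" and h: "h \<in> Bij ?S" "linear_on_sym h" by auto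
    have hS: "h X \<in> ?S" if "X \<in> ?S" for X
      using Bij_imp_funcset[OF h(1)] that by auto
    have "linear_on_sym (compose ?S f h)"
      using f(2) h(2) by (auto simp: linear_on_sym_def compose_def add scale hS)
    then show "f \<otimes>\<^bsub>?B\<^esub> h \<in> {f \<in> Bij ?S. linear_on_sym f}"
      using f h by (simp add: BijGroup_def compose_Bij)
  qed
  then show ?thesis
    unfolding Aut_sym_def by (rule B.subgroup_imp_group)
qed

definition orthogonal_rep :: "('g, 'b) monoid_scheme \<Rightarrow> ('g \<Rightarrow> real^'n^'n \<Rightarrow> real^'n^'n) \<Rightarrow> bool"
  where "orthogonal_rep G \<sigma> \<longleftrightarrow>
    (\<forall>g\<in>carrier G. \<forall>X\<in>sym_mats. \<forall>Y\<in>sym_mats.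
       trace_inner (\<sigma> g X) Y = trace_inner X ((inv\<^bsub>Aut_sym\<^esub> (\<sigma> g)) Y))"

definition sdp_invariant ::
    "('g, 'b) monoid_scheme \<Rightarrow> ('g \<Rightarrow> real^'n^'n \<Rightarrow> real^'n^'n) \<Rightarrow> (real^'n^'n) set \<Rightarrow> real^'n^'n \<Rightarrow> bool"
  where "sdp_invariant G \<sigma> L C \<longleftrightarrow>
    (\<forall>g\<in>carrier G. \<forall>X\<in>L \<inter> psd_mats. \<sigma> g X \<in> L \<inter> psd_mats) \<and>
    (\<forall>g\<in>carrier G. \<forall>X\<in>L \<inter> psd_mats. trace_inner C X = trace_inner C (\<sigma> g X))"

definition fixed_subspace ::
    "('g, 'b) monoid_scheme \<Rightarrow> ('g \<Rightarrow> real^'n^'n \<Rightarrow> real^'n^'n) \<Rightarrow> (real^'n^'n) set"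
  where "fixed_subspace G \<sigma> = {X \<in> sym_mats. \<forall>g\<in>carrier G. X = \<sigma> g X}"

text \<open>The optimal value is an extended real: an infeasible problem has value
  \<^term>\<open>\<infinity> :: ereal\<close>, one that is unbounded below has value \<^term>\<open>-\<infinity> :: ereal\<close>.\<close>

definition opt_value :: "real^'n^'n \<Rightarrow> (real^'n^'n) set \<Rightarrow> ereal"
  where "opt_value C K = (INF X\<in>K. ereal (trace_inner C X))"

end

theory Submission
  imports Defs
begin

text \<open>
  Restricting to fixed points shrinks the feasible set, so it can only raise the optimal value.
  For the converse, replace a feasible \<open>X\<close> by its orbit average, the mean of
  \<open>\<sigma> g X\<close> over \<open>g\<close> in \<open>G\<close>. Invariance of the program makes every
  \<open>\<sigma> g X\<close> feasible and equal in cost to \<open>X\<close>. The feasible set is convex, being the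
  intersection of an affine set with the positive semidefinite cone, so the average is feasible
  (\<open>orbit_average_in_convex\<close>); the cost is linear, so the average costs as much as \<open>X\<close>
  (\<open>trace_inner_orbit_average\<close>). Finally \<open>\<sigma> h\<close> only permutes the terms of the average, by
  left translation of \<open>G\<close>, so the average is a fixed point
  (\<open>orbit_average_in_fixed_subspace\<close>). Hence every cost attained on the feasible set is
  already attained on its fixed points, and the two infima agree even when neither is attained,
  and also when the program is infeasible or unbounded below.
\<close>

lemma convex_psd_mats: "convex (psd_mats :: (real^'n^'n) set)"
proof (rule convexI)
  fix X Y :: "real^'n^'n" and a b :: real
  assume X: "X \<in> psd_mats" and Y: "Y \<in> psd_mats" and ab: "0 \<le> a" "0 \<le> b"
  have "a *\<^sub>R X + b *\<^sub>R Y \<in> sym_mats"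
    using X Y subspace_sym_mats by (auto simp: psd_mats_def intro: subspace_add subspace_scale)
  moreover have "v \<bullet> ((a *\<^sub>R X + b *\<^sub>R Y) *v v) \<ge> 0" for v
  proof -
    have "v \<bullet> ((a *\<^sub>R X + b *\<^sub>R Y) *v v) = a * (v \<bullet> (X *v v)) + b * (v \<bullet> (Y *v v))"
      by (simp add: matrix_vector_mult_add_rdistrib scaleR_matrix_vector_assoc[symmetric]
          inner_add_right)
    then show ?thesis using X Y ab by (simp add: psd_mats_def)
  qed
  ultimately show "a *\<^sub>R X + b *\<^sub>R Y \<in> psd_mats"
    by (simp add: psd_mats_def)
qed

lemma linear_on_sym_sum:
  assumes f: "linear_on_sym f" and x: "\<And>i. i \<in> A \<Longrightarrow> x i \<in> sym_mats"
  shows "f (\<Sum>i\<in>A. x i) = (\<Sum>i\<in>A. f (x i))"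
proof -
  \<comment> \<open>Linearity is available on symmetric matrices only, so \<open>f 0 = 0\<close> comes from scaling
    the symmetric matrix \<open>0\<close> by \<open>0\<close>.\<close>
  have "f (0 *\<^sub>R 0) = 0 *\<^sub>R f 0"
    using f subspace_0[OF subspace_sym_mats] unfolding linear_on_sym_def by blast
  then have f0: "f 0 = 0" by simp
  show ?thesis
    using x
  proof (induction A rule: infinite_finite_induct)
    case (insert a A)
    have "(\<Sum>i\<in>A. x i) \<in> sym_mats"
      using insert.prems by (intro subspace_sum[OF subspace_sym_mats]) auto
    then have "f (x a + (\<Sum>i\<in>A. x i)) = f (x a) + f (\<Sum>i\<in>A. x i)"
      using f insert.prems by (simp add: linear_on_sym_def)
    then show ?case using insert by simp
  qed (simp_all add: f0)
qed

lemma hom_Aut_sym_linear: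
  assumes "\<sigma> \<in> hom G Aut_sym" and "g \<in> carrier G"
  shows "linear_on_sym (\<sigma> g)"
  using hom_in_carrier[OF assms] by (simp add: Aut_sym_def)

lemma hom_Aut_sym_closed:
  assumes "\<sigma> \<in> hom G Aut_sym" and "g \<in> carrier G" and "X \<in> sym_mats"
  shows "\<sigma> g X \<in> sym_mats"
proof -
  have "\<sigma> g \<in> Bij sym_mats"
    using hom_in_carrier[OF assms(1,2)] by (simp add: Aut_sym_def)
  then show ?thesis using Bij_imp_funcset assms(3) by blast
qed

lemma hom_Aut_sym_mult:
  assumes \<sigma>: "\<sigma> \<in> hom G Aut_sym" and "h \<in> carrier G" "g \<in> carrier G" and "X \<in> sym_mats"
  shows "\<sigma> (h \<otimes>\<^bsub>G\<^esub> g) X = \<sigma> h (\<sigma> g X)"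
proof -
  have "\<sigma> h \<in> Bij sym_mats" "\<sigma> g \<in> Bij sym_mats"
    using assms hom_in_carrier[OF \<sigma>] by (auto simp: Aut_sym_def)
  then have "\<sigma> (h \<otimes>\<^bsub>G\<^esub> g) = compose sym_mats (\<sigma> h) (\<sigma> g)"
    using hom_mult[OF assms(1-3)] by (simp add: Aut_sym_def BijGroup_def)
  then show ?thesis using assms by (simp add: compose_def)
qed

definition orbit_average ::
    "('g, 'b) monoid_scheme \<Rightarrow> ('g \<Rightarrow> real^'n^'n \<Rightarrow> real^'n^'n) \<Rightarrow> real^'n^'n \<Rightarrow> real^'n^'n"
  where "orbit_average G \<sigma> X = (1 / real (card (carrier G))) *\<^sub>R (\<Sum>g\<in>carrier G. \<sigma> g X)"

text \<open>This is the Reynolds operator projecting onto the fixed points: applying \<open>\<sigma> h\<close> turns the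
  sum over \<open>g\<close> into the sum over \<open>h \<otimes>\<^bsub>G\<^esub> g\<close>, and left translation by \<open>h\<close> is a permutation
  of the group.\<close>

lemma orbit_average_in_fixed_subspace:
  assumes G: "group G" and \<sigma>: "\<sigma> \<in> hom G Aut_sym" and X: "X \<in> sym_mats"
  shows "orbit_average G \<sigma> X \<in> fixed_subspace G \<sigma>"
proof -
  interpret group G by (rule G)
  have mem: "\<sigma> g X \<in> sym_mats" if "g \<in> carrier G" for g
    using hom_Aut_sym_closed[OF \<sigma> that X] .
  have sum_mem: "(\<Sum>g\<in>carrier G. \<sigma> g X) \<in> sym_mats"
    by (intro subspace_sum[OF subspace_sym_mats] mem)
  have "\<sigma> h (orbit_average G \<sigma> X) = orbit_average G \<sigma> X" if h: "h \<in> carrier G" for h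
  proof -
    note lin = hom_Aut_sym_linear[OF \<sigma> h]
    have "\<sigma> h (\<Sum>g\<in>carrier G. \<sigma> g X) = (\<Sum>g\<in>carrier G. \<sigma> h (\<sigma> g X))"
      by (rule linear_on_sym_sum[OF lin mem])
    also have "\<dots> = (\<Sum>g\<in>carrier G. \<sigma> (h \<otimes>\<^bsub>G\<^esub> g) X)"
      using hom_Aut_sym_mult[OF \<sigma> h _ X] by simp
    also have "\<dots> = (\<Sum>g\<in>carrier G. \<sigma> g X)"
    proof (rule sum.reindex_bij_witness)
      fix g assume g: "g \<in> carrier G"
      show "inv\<^bsub>G\<^esub> h \<otimes>\<^bsub>G\<^esub> (h \<otimes>\<^bsub>G\<^esub> g) = g" "h \<otimes>\<^bsub>G\<^esub> (inv\<^bsub>G\<^esub> h \<otimes>\<^bsub>G\<^esub> g) = g"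
        using g h by (simp_all add: m_assoc[symmetric])
    qed (use h in auto)
    finally show ?thesis
      using lin sum_mem by (simp add: orbit_average_def linear_on_sym_def)
  qed
  moreover have "orbit_average G \<sigma> X \<in> sym_mats"
    unfolding orbit_average_def by (rule subspace_scale[OF subspace_sym_mats sum_mem])
  ultimately show ?thesis
    by (simp add: fixed_subspace_def)
qed

lemma orbit_average_in_convex:
  assumes "group G" and "finite (carrier G)" and "convex K"
    and "\<And>g. g \<in> carrier G \<Longrightarrow> \<sigma> g X \<in> K"
  shows "orbit_average G \<sigma> X \<in> K"
proof -
  have "card (carrier G) > 0"
    using assms(2) monoid.one_closed[OF group.is_monoid[OF assms(1)]] by (auto simp: card_gt_0_iff)
  then have "(\<Sum>g\<in>carrier G. (1 / real (card (carrier G))) *\<^sub>R \<sigma> g X) \<in> K"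
    using assms by (intro convex_sum) auto
  then show ?thesis
    by (simp add: orbit_average_def scaleR_sum_right)
qed

lemma trace_inner_orbit_average:
  assumes "group G" and "finite (carrier G)" and "C \<in> sym_mats"
    and eq: "\<And>g. g \<in> carrier G \<Longrightarrow> trace_inner C (\<sigma> g X) = c"
  shows "trace_inner C (orbit_average G \<sigma> X) = c"
proof -
  have "card (carrier G) > 0"
    using assms(2) monoid.one_closed[OF group.is_monoid[OF assms(1)]] by (auto simp: card_gt_0_iff)
  moreover have "(\<Sum>g\<in>carrier G. C \<bullet> \<sigma> g X) = real (card (carrier G)) * c"
    using eq by (simp add: trace_inner_eq_inner[OF \<open>C \<in> sym_mats\<close>])
  ultimately show ?thesis
    by (simp add: trace_inner_eq_inner[OF \<open>C \<in> sym_mats\<close>] orbit_average_def inner_sum_right)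
qed

theorem theorem3p3:
  fixes G :: "('g, 'b) monoid_scheme"
    and \<sigma> :: "'g \<Rightarrow> real^'n^'n \<Rightarrow> real^'n^'n"
    and L :: "(real^'n^'n) set"
    and C :: "real^'n^'n"
  assumes "group G" and "finite (carrier G)"
    and "\<sigma> \<in> hom G Aut_sym"
    and "orthogonal_rep G \<sigma>"
    and "\<forall>g\<in>carrier G. \<sigma> g ` psd_mats \<subseteq> psd_mats"
    and "L \<subseteq> sym_mats" and "affine L"
    and "C \<in> sym_mats"
    and "sdp_invariant G \<sigma> L C"
  shows "opt_value C (L \<inter> psd_mats) = opt_value C (fixed_subspace G \<sigma> \<inter> L \<inter> psd_mats)"
proof (rule antisym)
  show "opt_value C (L \<inter> psd_mats) \<le> opt_value C (fixed_subspace G \<sigma> \<inter> L \<inter> psd_mats)"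
    unfolding opt_value_def by (rule INF_superset_mono) auto
  have "opt_value C (fixed_subspace G \<sigma> \<inter> L \<inter> psd_mats) \<le> ereal (trace_inner C X)"
    if X: "X \<in> L \<inter> psd_mats" for X
  proof -
    let ?Y = "orbit_average G \<sigma> X"
    have "convex (L \<inter> psd_mats)"
      using \<open>affine L\<close> by (intro convex_Int affine_imp_convex convex_psd_mats)
    then have "?Y \<in> L \<inter> psd_mats"
      using assms(1,2,9) X by (intro orbit_average_in_convex) (auto simp: sdp_invariant_def)
    moreover have "?Y \<in> fixed_subspace G \<sigma>"
      using assms(1,3,6) X by (intro orbit_average_in_fixed_subspace) auto
    ultimately have "?Y \<in> fixed_subspace G \<sigma> \<inter> L \<inter> psd_mats" by blast
    moreover have "trace_inner C ?Y = trace_inner C X"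
    proof (rule trace_inner_orbit_average[OF assms(1,2,8)])
      show "trace_inner C (\<sigma> g X) = trace_inner C X" if "g \<in> carrier G" for g
        using assms(9) X that unfolding sdp_invariant_def by metis
    qed
    ultimately show ?thesis
      unfolding opt_value_def by (metis INF_lower)
  qed
  then show "opt_value C (fixed_subspace G \<sigma> \<inter> L \<inter> psd_mats) \<le> opt_value C (L \<inter> psd_mats)"
    unfolding opt_value_def[of C "L \<inter> psd_mats"] by (rule INF_greatest)
qed

end
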